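(* Let $R(3)=\limsup_{n\to\infty}\frac{\log_2 SSM(3,n)}{n}$, where $SSM(3,n)$ is the maximum possible number of columns of a strongly $3$-separable matrix with $n$ rows. Then $R(3)\ge 0.0974$.
   Context: Let $M\ge n\ge 2$ be integers and let $B$ be a binary ($0$-$1$) matrix of size $n\times M$ with set of column vectors $\mathcal{F}=\{c_1,\ldots,c_M\}\subseteq\{0,1\}^n$ (the columns being pairwise distinct, $|\mathcal{F}|=M$). The Boolean sum $\bigvee$ of a set of columns is their coordinatewise maximum (OR). The matrix $B$ is called strongly $t$-separable (a $t$-SSM) if for every $\mathcal{F}_0\subseteq\mathcal{F}$ with $|\mathcal{F}_0|=t$ we have $\bigcap_{\mathcal{F}'\in\mathcal{U}(\mathcal{F}_0)}\mathcal{F}'=\mathcal{F}_0$, where $\mathcal{U}(\mathcal{F}_0)=\{\mathcal{F}'\subseteq\mathcal{F}:\ \bigvee_{c\in\mathcal{F}_0}c=\bigvee_{c\in\mathcal{F}'}c\}$. $SSM(t,n)$ denotes the maximum possible number of columns of a $t$-SSM with $n$ rows. *)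

theory Defs
  imports Complex_Main "HOL-Library.Extended_Real" "HOL-Library.Liminf_Limsup"
    "Jordan_Normal_Form.Matrix"
begin

definition binary_matrix :: "nat \<Rightarrow> nat \<Rightarrow> nat mat \<Rightarrow> bool" where
  "binary_matrix n M B \<longleftrightarrow> B \<in> carrier_mat n M \<and> elements_mat B \<subseteq> {0, 1}"

(* The inserted 0 makes the Boolean sum of the empty family the zero vector;
   for a nonempty family it does not change the maximum. *)
definition boolean_sum :: "nat \<Rightarrow> nat vec set \<Rightarrow> nat vec" where
  "boolean_sum n S = vec n (\<lambda>i. Max (insert 0 ((\<lambda>c. c $ i) ` S)))"

definition same_sum_families :: "nat \<Rightarrow> nat vec set \<Rightarrow> nat vec set \<Rightarrow> nat vec set set" where
  "same_sum_families n F F0 = {F'. F' \<subseteq> F \<and> boolean_sum n F0 = boolean_sum n F'}"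

definition strongly_separable :: "nat \<Rightarrow> nat \<Rightarrow> nat \<Rightarrow> nat mat \<Rightarrow> bool" where
  "strongly_separable t n M B \<longleftrightarrow>
     2 \<le> n \<and> n \<le> M \<and> binary_matrix n M B \<and> distinct (cols B) \<and>
     (\<forall>F0. F0 \<subseteq> set (cols B) \<and> card F0 = t \<longrightarrow>
        \<Inter> (same_sum_families n (set (cols B)) F0) = F0)"

(* For n >= 2 the set is nonempty (identity matrix) and bounded by 2 ^ n; for n < 2 it is
   empty and the value is irrelevant. *)
definition SSM :: "nat \<Rightarrow> nat \<Rightarrow> nat" where
  "SSM t n = Max {M. \<exists>B. strongly_separable t n M B}"

(* The limit superior is taken in the extended reals, where it always exists. *)
definition SSM_rate :: "nat \<Rightarrow> ereal" where
  "SSM_rate t = limsup (\<lambda>n. ereal (log 2 (real (SSM t n)) / real n))"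

end

theory Submission
  imports Defs "HOL-Library.FuncSet" "HOL-Real_Asymp.Real_Asymp"
begin

text \<open>
  The bound comes from random coding with expurgation, applied to words over an alphabet of seven
  letters. A word of length N becomes a 0-1 column with n = 7 N rows by marking, in each of N blocks
  of seven rows, the row of the letter that occurs there. The letters of independent uniform words
  are independent over the blocks, so every probability below is an N-th power of the probability
  in a single block.

  Strong 3-separability would follow if no column lay below the Boolean sum of three others, but
  that demand is too expensive. It suffices to exclude three configurations of distinct columns
  (lemma \<open>separable_system_3_image\<close>): a below the sum of b and c; the sums of a, b, c
  and of x, b, c equal; two columns x, y both below the sum of a, b, c. The third exclusion
  leaves at most one foreign column below any triple, and the first two deal with the families
  containing none or one of these.

  In one block the three configurations have probabilities 13/49, 61/343 and 1/7
  (lemmas \<open>card_in_pair\<close>, \<open>card_same_triple\<close>,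
  \<open>card_two_in_triple\<close>). Among K random words the expected number of bad
  configurations is therefore at most K^3 (13/49)^N + K^4 (61/343)^N + K^5 (1/7)^N. Whenever this is
  at most K/2, deleting one word from each bad configuration leaves at least K/2 words
  (lemma \<open>exists_separable_words\<close>). With K about \<beta>^N the three terms are small compared
  with K as soon as \<beta>^2 < 49/13, \<beta>^3 < 343/61 and \<beta>^4 < 7. The last condition is
  the binding one, and \<beta> = 13/8 satisfies all three. The resulting rate along the row numbers
  n = 7 N is log 2 (13/8) / 7, which is at least 1/10 because 2^7 \<le> (13/8)^10.

  Seven letters are a good choice for the binding condition: with q letters, two words are both
  below three others in one block with probability E[d^2] / q^2, where d is the number of
  distinct letters among the three, and at q = 7 this is exactly 1/7.
\<close>

section \<open>Set systems and strongly separable matrices\<close>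

definition separable_system :: "nat \<Rightarrow> 'a set set \<Rightarrow> bool" where
  "separable_system t \<C> \<longleftrightarrow>
     (\<forall>X Y. X \<subseteq> \<C> \<and> card X = t \<and> Y \<subseteq> \<C> \<and> \<Union>Y = \<Union>X \<longrightarrow> X \<subseteq> Y)"

text \<open>The function e labels the n rows by points of a ground set; this allows pairs of a
  position and a letter to serve as rows without an arithmetic encoding.\<close>

definition indicator_vec :: "nat \<Rightarrow> (nat \<Rightarrow> 'a) \<Rightarrow> 'a set \<Rightarrow> nat vec" where
  "indicator_vec n e X = vec n (\<lambda>r. of_bool (e r \<in> X))"

lemma boolean_sum_indicator_vec:
  assumes "finite X"
  shows "boolean_sum n (indicator_vec n e ` X) = indicator_vec n e (\<Union>X)"
proof (rule eq_vecI)
  fix r assume "r < dim_vec (indicator_vec n e (\<Union>X))"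
  then have r: "r < n" by (simp add: indicator_vec_def)
  let ?V = "insert 0 ((\<lambda>c. c $ r) ` indicator_vec n e ` X)"
  have V: "?V = insert 0 ((\<lambda>Z. of_bool (e r \<in> Z)) ` X)"
    using r by (simp add: indicator_vec_def image_image)
  have "Max ?V = of_bool (e r \<in> \<Union>X)"
    unfolding V using assms by (intro Max_eqI) auto
  then show "boolean_sum n (indicator_vec n e ` X) $ r = indicator_vec n e (\<Union>X) $ r"
    using r by (simp add: boolean_sum_def indicator_vec_def)
qed (simp add: boolean_sum_def indicator_vec_def)

lemma inj_on_indicator_vec:
  assumes "U \<subseteq> e ` {..<n}"
  shows "inj_on (indicator_vec n e) (Pow U)"
proof (rule inj_onI)
  fix X Y assume XY: "X \<in> Pow U" "Y \<in> Pow U" and eq: "indicator_vec n e X = indicator_vec n e Y"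
  have "e r \<in> X \<longleftrightarrow> e r \<in> Y" if "r < n" for r
    using arg_cong[OF eq, of "\<lambda>v. v $ r"] that by (simp add: indicator_vec_def of_bool_eq_iff)
  then show "X = Y" using XY assms by blast
qed

text \<open>Distinct binary columns are distinct indicators of subsets of the n rows. Finiteness is
  what makes the maximum in the definition of SSM an upper bound for every attained size.\<close>

lemma finite_strongly_separable_sizes: "finite {M. \<exists>B. strongly_separable t n M B}"
proof (rule finite_subset)
  show "{M. \<exists>B. strongly_separable t n M B} \<subseteq> {..2 ^ n}"
  proof clarsimp
    fix M B assume "strongly_separable t n M B"
    then have B: "B \<in> carrier_mat n M" "elements_mat B \<subseteq> {0, 1}" and dist: "distinct (cols B)"
      by (auto simp: strongly_separable_def binary_matrix_def)
    define W :: "nat vec set" where "W = indicator_vec n id ` Pow {..<n}"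
    have "set (cols B) \<subseteq> W"
    proof
      fix c assume "c \<in> set (cols B)"
      then obtain j where j: "j < M" "c = col B j"
        using B by (auto simp: cols_def)
      have "B $$ (r, j) \<in> {0, 1}" if "r < n" for r
        using that j B by (intro subsetD[OF B(2)]) (auto simp: elements_mat_def intro!: bexI[of _ r] imageI)
      then have "c = indicator_vec n id {r. r < n \<and> c $ r = 1}"
        using j B by (intro eq_vecI) (auto simp: indicator_vec_def)
      then show "c \<in> W" unfolding W_def by blast
    qed
    moreover have "finite W" "card W \<le> 2 ^ n"
      unfolding W_def using card_image_le[of "Pow {..<n}" "indicator_vec n id"]
      by (auto simp: card_Pow)
    ultimately have "card (set (cols B)) \<le> 2 ^ n"
      by (meson card_mono le_trans)
    then show "M \<le> 2 ^ n" using distinct_card[OF dist] B by simp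
  qed
qed simp

text \<open>This translates Boolean sums into unions, so that the construction can be carried out with
  finite sets.\<close>

lemma card_le_SSM:
  assumes U: "finite U" "card U = n" and \<C>: "\<C> \<subseteq> Pow U"
    and n: "2 \<le> n" "n \<le> card \<C>" and sep: "separable_system t \<C>"
  shows "card \<C> \<le> SSM t n"
proof -
  obtain e where e: "bij_betw e {..<n} U"
    using U ex_bij_betw_nat_finite[of U] by (auto simp: atLeast0LessThan)
  define v where "v = indicator_vec n e"
  have v_inj: "inj_on v (Pow U)"
    unfolding v_def using e by (intro inj_on_indicator_vec) (simp add: bij_betw_def)
  have fin: "finite \<C>" using \<C> U by (meson finite_Pow_iff finite_subset)
  then obtain Cs where Cs: "set Cs = \<C>" "distinct Cs"
    using finite_distinct_list by blast
  have len: "length Cs = card \<C>" using Cs distinct_card by fastforce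
  define B where "B = mat_of_cols n (map v Cs)"
  have colsB: "cols B = map v Cs"
    unfolding B_def by (intro cols_mat_of_cols) (auto simp: v_def indicator_vec_def)
  have "strongly_separable t n (card \<C>) B"
    unfolding strongly_separable_def
  proof (intro conjI allI impI)
    show "binary_matrix n (card \<C>) B"
      unfolding binary_matrix_def B_def using len
      by (auto simp: elements_mat_def mat_of_cols_def v_def indicator_vec_def)
    show "distinct (cols B)"
      unfolding colsB using Cs v_inj \<C> by (auto simp: distinct_map intro: inj_on_subset)
    fix F0 assume F0: "F0 \<subseteq> set (cols B) \<and> card F0 = t"
    then obtain X where X: "X \<subseteq> \<C>" "F0 = v ` X"
      by (auto simp: colsB Cs subset_image_iff)
    have cX: "card X = t"
      using F0 X \<C> card_image[of v X] v_inj by (metis inj_on_subset)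
    have sub: "F0 \<subseteq> F'" if F': "F' \<in> same_sum_families n (set (cols B)) F0" for F'
    proof -
      obtain Y where Y: "Y \<subseteq> \<C>" "F' = v ` Y"
        using F' by (auto simp: same_sum_families_def colsB Cs subset_image_iff)
      have finXY: "finite X" "finite Y" using X Y fin by (auto intro: finite_subset)
      have "boolean_sum n (v ` X) = boolean_sum n (v ` Y)"
        using F' X(2) Y(2) by (simp add: same_sum_families_def)
      then have "v (\<Union>Y) = v (\<Union>X)"
        unfolding v_def using finXY by (simp add: boolean_sum_indicator_vec)
      moreover have "\<Union>Y \<in> Pow U" "\<Union>X \<in> Pow U"
        using X(1) Y(1) \<C> by blast+
      ultimately have "\<Union>Y = \<Union>X"
        using v_inj by (rule inj_onD[rotated])
      then have "X \<subseteq> Y"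
        using sep X Y cX unfolding separable_system_def by blast
      then show ?thesis using X Y by blast
    qed
    moreover have "F0 \<in> same_sum_families n (set (cols B)) F0"
      using F0 by (auto simp: same_sum_families_def)
    ultimately show "\<Inter> (same_sum_families n (set (cols B)) F0) = F0"
      by blast
  qed (use n in auto)
  then show ?thesis
    unfolding SSM_def using finite_strongly_separable_sizes by (intro Max_ge) auto
qed

text \<open>Let J be a subfamily with the same union as the triple a, b, c, and suppose that a is
  missing from J. Every member of J lies below the triple, so the third exclusion leaves at most
  one member x outside the triple. Without such an x, a is covered by b and c; with it,
  replacing a by x does not change the union.\<close>

lemma separable_system_3_image:
  assumes two: "\<And>a b c. \<lbrakk>a \<in> S; b \<in> S; c \<in> S; distinct [a, b, c]\<rbrakk> \<Longrightarrow> \<not> C a \<subseteq> C b \<union> C c"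
    and swap: "\<And>a b c x. \<lbrakk>a \<in> S; b \<in> S; c \<in> S; x \<in> S; distinct [a, b, c, x]\<rbrakk>
      \<Longrightarrow> C a \<union> C b \<union> C c \<noteq> C x \<union> C b \<union> C c"
    and covered: "\<And>a b c x y. \<lbrakk>a \<in> S; b \<in> S; c \<in> S; x \<in> S; y \<in> S; distinct [a, b, c, x, y]\<rbrakk>
      \<Longrightarrow> \<not> (C x \<subseteq> C a \<union> C b \<union> C c \<and> C y \<subseteq> C a \<union> C b \<union> C c)"
  shows "separable_system 3 (C ` S)"
proof -
  have essential: "a \<in> J"
    if abc: "a \<in> S" "b \<in> S" "c \<in> S" "distinct [a, b, c]"
      and J: "J \<subseteq> S" "\<Union> (C ` J) = C a \<union> C b \<union> C c" for a b c J
  proof (rule ccontr)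
    assume a: "a \<notin> J"
    show False
    proof (cases "J \<subseteq> {b, c}")
      case True
      then have "C a \<subseteq> C b \<union> C c" using J by blast
      then show False using two abc by blast
    next
      case False
      then obtain x where x: "x \<in> J" "x \<noteq> a" "x \<noteq> b" "x \<noteq> c" using a by blast
      have sub: "C z \<subseteq> C a \<union> C b \<union> C c" if "z \<in> J" for z
        using J that by blast
      have "J \<subseteq> {b, c, x}"
      proof
        fix y assume y: "y \<in> J"
        show "y \<in> {b, c, x}"
          using covered[of a b c x y] sub[OF y] sub[OF x(1)] abc x y a J(1) by auto
      qed
      then have "C a \<union> C b \<union> C c = C x \<union> C b \<union> C c"
        using J(2) sub[OF x(1)] by blast
      then show False using swap[of a b c x] abc x J(1) by auto
    qed
  qed
  show ?thesis
    unfolding separable_system_def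
  proof (intro allI impI, elim conjE)
    fix X Y assume X: "X \<subseteq> C ` S" "card X = 3" and Y: "Y \<subseteq> C ` S" "\<Union>Y = \<Union>X"
    obtain A1 A2 A3 where A: "X = {A1, A2, A3}" "distinct [A1, A2, A3]"
      using X(2) by (auto simp: card_3_iff)
    then obtain a b c where abc: "a \<in> S" "b \<in> S" "c \<in> S" "A1 = C a" "A2 = C b" "A3 = C c"
      using X(1) by auto
    obtain J where J: "J \<subseteq> S" "Y = C ` J" using Y(1) by (auto simp: subset_image_iff)
    have U: "\<Union> (C ` J) = C a \<union> C b \<union> C c" using Y(2) J A abc by auto
    have d: "distinct [a, b, c]" using A abc by auto
    have "a \<in> J" using essential[OF abc(1,2,3) d J(1) U] .
    moreover have "b \<in> J" by (rule essential[of b a c]) (use abc d J(1) U in auto)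
    moreover have "c \<in> J" by (rule essential[of c a b]) (use abc d J(1) U in auto)
    ultimately show "X \<subseteq> Y" using A J abc by auto
  qed
qed

section \<open>Counting letter patterns\<close>

text \<open>In this part, a map g from the index set I of the words to the alphabet A is a single
  block of the code: it gives the letter of every word there.\<close>

lemma sum_PiE_split:
  assumes "a \<in> I"
  shows "(\<Sum>g\<in>I \<rightarrow>\<^sub>E A. F g) = (\<Sum>y\<in>A. \<Sum>g\<in>(I - {a}) \<rightarrow>\<^sub>E A. F (g(a := y)))"
proof -
  have I: "insert a (I - {a}) = I" using assms by blast
  have "(\<Sum>g\<in>I \<rightarrow>\<^sub>E A. F g)
      = sum F ((\<lambda>(y, g). g(a := y)) ` (A \<times> ((I - {a}) \<rightarrow>\<^sub>E A)))"
    using PiE_insert_eq[of a "I - {a}" "\<lambda>_. A"] by (simp only: I)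
  also have "\<dots> = (\<Sum>(y, g)\<in>A \<times> ((I - {a}) \<rightarrow>\<^sub>E A). F (g(a := y)))"
    using inj_combinator[of a "I - {a}" "\<lambda>_. A"]
    by (subst sum.reindex) (simp_all add: case_prod_unfold)
  finally show ?thesis by (simp add: sum.cartesian_product)
qed

lemma card_PiE_filter:
  assumes "finite I" "finite A"
  shows "card {g \<in> I \<rightarrow>\<^sub>E A. P g} = (\<Sum>g\<in>I \<rightarrow>\<^sub>E A. of_bool (P g))"
proof -
  have "finite (I \<rightarrow>\<^sub>E A)" using assms by (intro finite_PiE) auto
  then show ?thesis by (simp add: sum_of_bool_eq Int_def)
qed

text \<open>A new letter a either repeats one of the letters in S or increases their number by
  one. Iterating this evaluates any sum over pairs or triples of letters that depends only on the
  number of distinct letters.\<close>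

lemma sum_card_insert:
  fixes \<phi> :: "nat \<Rightarrow> nat"
  assumes "finite A" "S \<subseteq> A"
  shows "(\<Sum>a\<in>A. \<phi> (card (insert a S))) = card S * \<phi> (card S) + (card A - card S) * \<phi> (Suc (card S))"
proof -
  have S: "finite S" using assms finite_subset by blast
  have "(\<Sum>a\<in>A. \<phi> (card (insert a S)))
      = (\<Sum>a\<in>A - S. \<phi> (card (insert a S))) + (\<Sum>a\<in>S. \<phi> (card (insert a S)))"
    using assms by (intro sum.subset_diff) auto
  also have "(\<Sum>a\<in>A - S. \<phi> (card (insert a S))) = (\<Sum>a\<in>A - S. \<phi> (Suc (card S)))"
    using S by (intro sum.cong) auto
  also have "(\<Sum>a\<in>S. \<phi> (card (insert a S))) = (\<Sum>a\<in>S. \<phi> (card S))"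
    by (intro sum.cong) (auto simp: insert_absorb)
  finally show ?thesis using assms S by (simp add: card_Diff_subset)
qed

lemma sum_card_pair:
  fixes \<phi> :: "nat \<Rightarrow> nat"
  assumes "finite A"
  shows "(\<Sum>c\<in>A. \<Sum>b\<in>A. \<phi> (card {b, c})) = card A * (\<phi> 1 + (card A - 1) * \<phi> 2)"
  using sum_card_insert[OF assms, of "{c}" \<phi> for c]
  by (simp add: numeral_2_eq_2)

lemma sum_card_triple:
  fixes \<phi> :: "nat \<Rightarrow> nat"
  assumes "finite A"
  shows "(\<Sum>c\<in>A. \<Sum>b\<in>A. \<Sum>a\<in>A. \<phi> (card {a, b, c}))
    = card A * (\<phi> 1 + (card A - 1) * \<phi> 2
        + (card A - 1) * (2 * \<phi> 2 + (card A - 2) * \<phi> 3))"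
proof -
  have "(\<Sum>c\<in>A. \<Sum>b\<in>A. \<Sum>a\<in>A. \<phi> (card {a, b, c}))
    = (\<Sum>c\<in>A. \<Sum>b\<in>A. (\<lambda>m. m * \<phi> m + (card A - m) * \<phi> (Suc m)) (card {b, c}))"
    using assms by (intro sum.cong refl) (simp add: sum_card_insert)
  also have "\<dots> = card A * (\<phi> 1 + (card A - 1) * \<phi> 2
        + (card A - 1) * (2 * \<phi> 2 + (card A - 2) * \<phi> 3))"
    by (subst sum_card_pair[OF assms]) (simp add: numeral_2_eq_2 numeral_3_eq_3)
  finally show ?thesis .
qed

text \<open>Independence in counting form: a uniformly chosen g has independent uniform values at
  distinct indices. The indices of the triple are summed outermost, since the inner sums below
  depend on the triple only through the number of its distinct letters.\<close>

lemma sum_PiE_letters: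
  fixes F3 :: "'b \<Rightarrow> 'b \<Rightarrow> 'b \<Rightarrow> nat"
    and F4 :: "'b \<Rightarrow> 'b \<Rightarrow> 'b \<Rightarrow> 'b \<Rightarrow> nat"
    and F5 :: "'b \<Rightarrow> 'b \<Rightarrow> 'b \<Rightarrow> 'b \<Rightarrow> 'b \<Rightarrow> nat"
  assumes I: "finite I" and A: "finite A"
  shows sum_PiE_letters_3:
    "\<lbrakk>{a, b, c} \<subseteq> I; distinct [a, b, c]\<rbrakk> \<Longrightarrow>
      (\<Sum>g\<in>I \<rightarrow>\<^sub>E A. F3 (g a) (g b) (g c))
        = (\<Sum>k\<in>A. \<Sum>j\<in>A. \<Sum>i\<in>A. F3 i j k) * card A ^ (card I - 3)"
  and sum_PiE_letters_4:
    "\<lbrakk>{a, b, c, x} \<subseteq> I; distinct [x, a, b, c]\<rbrakk> \<Longrightarrow>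
      (\<Sum>g\<in>I \<rightarrow>\<^sub>E A. F4 (g a) (g b) (g c) (g x))
        = (\<Sum>k\<in>A. \<Sum>j\<in>A. \<Sum>i\<in>A. \<Sum>l\<in>A. F4 i j k l) * card A ^ (card I - 4)"
  and sum_PiE_letters_5:
    "\<lbrakk>{a, b, c, x, y} \<subseteq> I; distinct [y, x, a, b, c]\<rbrakk> \<Longrightarrow>
      (\<Sum>g\<in>I \<rightarrow>\<^sub>E A. F5 (g a) (g b) (g c) (g x) (g y))
        = (\<Sum>k\<in>A. \<Sum>j\<in>A. \<Sum>i\<in>A. \<Sum>l\<in>A. \<Sum>m\<in>A. F5 i j k l m) * card A ^ (card I - 5)"
  subgoal
    using I A by (simp add: sum_PiE_split[of c] sum_PiE_split[of b] sum_PiE_split[of a]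
        card_PiE sum_distrib_left sum_distrib_right
        eval_nat_numeral mult.commute)
  subgoal
    using I A by (simp add: sum_PiE_split[of c] sum_PiE_split[of b] sum_PiE_split[of a]
        sum_PiE_split[of x] card_PiE sum_distrib_left sum_distrib_right
        eval_nat_numeral mult.commute)
  subgoal
    using I A by (simp add: sum_PiE_split[of c] sum_PiE_split[of b] sum_PiE_split[of a]
        sum_PiE_split[of x] sum_PiE_split[of y] card_PiE sum_distrib_left sum_distrib_right
        eval_nat_numeral mult.commute)
  done

text \<open>There are 7 pairs with one letter and 42 pairs with two, and
  7 * 1 + 42 * 2 = 91.\<close>

lemma card_in_pair:
  assumes I: "finite I" "{a, b, c} \<subseteq> I" "distinct [a, b, c]"
    and A: "finite A" "card A = 7"
  shows "card {g \<in> I \<rightarrow>\<^sub>E A. g a \<in> {g b, g c}} = 91 * 7 ^ (card I - 3)"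
proof -
  have inner: "(\<Sum>i\<in>A. of_bool (i \<in> {j, k})) = card {j, k}" if "j \<in> A" "k \<in> A" for j k
  proof -
    have "A \<inter> {i. i \<in> {j, k}} = {j, k}" using that by blast
    then show ?thesis using A(1) by (simp only: sum_of_bool_eq of_nat_id)
  qed
  have "card {g \<in> I \<rightarrow>\<^sub>E A. g a \<in> {g b, g c}}
      = (\<Sum>k\<in>A. \<Sum>j\<in>A. \<Sum>i\<in>A. of_bool (i \<in> {j, k})) * 7 ^ (card I - 3)"
    unfolding card_PiE_filter[OF I(1) A(1)]
    using sum_PiE_letters_3[OF I(1) A(1) I(2,3), of "\<lambda>i j k. of_bool (i \<in> {j, k})"] A(2)
    by (simp only:)
  also have "(\<Sum>k\<in>A. \<Sum>j\<in>A. \<Sum>i\<in>A. of_bool (i \<in> {j, k})) = (\<Sum>k\<in>A. \<Sum>j\<in>A. card {j, k})"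
    by (intro sum.cong refl inner)
  also have "\<dots> = 91"
    using sum_card_pair[OF A(1), of "\<lambda>m. m"] A(2) by simp
  finally show ?thesis .
qed

text \<open>Let S consist of the letters of b and c. The sums agree iff both a and x have letters
  in S, or they share a letter outside S. Hence a pair with d = card S admits
  d^2 + (7 - d) choices: 7 * 7 + 42 * 9 = 427 in total.\<close>

lemma card_same_triple:
  assumes I: "finite I" "{a, b, c, x} \<subseteq> I" "distinct [a, b, c, x]"
    and A: "finite A" "card A = 7"
  shows "card {g \<in> I \<rightarrow>\<^sub>E A. {g a, g b, g c} = {g x, g b, g c}} = 427 * 7 ^ (card I - 4)"
proof -
  have inner: "(\<Sum>i\<in>A. \<Sum>l\<in>A. of_bool ({i, j, k} = {l, j, k}))
      = (card {j, k})\<^sup>2 + (7 - card {j, k})" if jk: "j \<in> A" "k \<in> A" for j k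
  proof -
    let ?S = "{j, k}"
    have S: "?S \<subseteq> A" using jk by blast
    have "(\<Sum>l\<in>A. of_bool ({i, j, k} = {l, j, k})) = (if i \<in> ?S then card ?S else 1)"
      if "i \<in> A" for i
    proof -
      have "A \<inter> {l. {i, j, k} = {l, j, k}} = (if i \<in> ?S then ?S else {i})"
        using that jk by auto
      then show ?thesis using A(1) by (simp only: sum_of_bool_eq of_nat_id) simp
    qed
    then have "(\<Sum>i\<in>A. \<Sum>l\<in>A. of_bool ({i, j, k} = {l, j, k}))
        = (\<Sum>i\<in>A. if i \<in> ?S then card ?S else 1)"
      by (intro sum.cong refl)
    also have "\<dots> = (\<Sum>i\<in>A - ?S. if i \<in> ?S then card ?S else 1)
        + (\<Sum>i\<in>?S. if i \<in> ?S then card ?S else 1)"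
      using A(1) S by (intro sum.subset_diff)
    also have "(\<Sum>i\<in>A - ?S. if i \<in> ?S then card ?S else 1) = (\<Sum>i\<in>A - ?S. 1)"
      by (intro sum.cong) auto
    also have "(\<Sum>i\<in>?S. if i \<in> ?S then card ?S else 1) = (\<Sum>i\<in>?S. card ?S)"
      by (intro sum.cong) auto
    finally show ?thesis
      using A(2) S by (simp add: card_Diff_subset power2_eq_square del: insert_subset)
  qed
  have d: "distinct [x, a, b, c]" using I(3) by auto
  have "card {g \<in> I \<rightarrow>\<^sub>E A. {g a, g b, g c} = {g x, g b, g c}}
      = (\<Sum>k\<in>A. \<Sum>j\<in>A. \<Sum>i\<in>A. \<Sum>l\<in>A. of_bool ({i, j, k} = {l, j, k})) * 7 ^ (card I - 4)"
    unfolding card_PiE_filter[OF I(1) A(1)]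
    using sum_PiE_letters_4[OF I(1) A(1) I(2) d, of "\<lambda>i j k l. of_bool ({i, j, k} = {l, j, k})"]
      A(2) by (simp only:)
  also have "(\<Sum>k\<in>A. \<Sum>j\<in>A. \<Sum>i\<in>A. \<Sum>l\<in>A. of_bool ({i, j, k} = {l, j, k}))
      = (\<Sum>k\<in>A. \<Sum>j\<in>A. (card {j, k})\<^sup>2 + (7 - card {j, k}))"
    by (intro sum.cong refl inner)
  also have "\<dots> = 427"
    using sum_card_pair[OF A(1), of "\<lambda>m. m\<^sup>2 + (7 - m)"] A(2) by simp
  finally show ?thesis .
qed

text \<open>A triple with d distinct letters admits d^2 pairs of letters for x and y, which gives
  7 * 1 + 126 * 4 + 210 * 9 = 2401 = 7^4; the probability is 7^4 / 7^5 = 1/7.\<close>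

lemma card_two_in_triple:
  assumes I: "finite I" "{a, b, c, x, y} \<subseteq> I" "distinct [a, b, c, x, y]"
    and A: "finite A" "card A = 7"
  shows "card {g \<in> I \<rightarrow>\<^sub>E A. g x \<in> {g a, g b, g c} \<and> g y \<in> {g a, g b, g c}}
    = 2401 * 7 ^ (card I - 5)"
proof -
  let ?P = "\<lambda>i j k l m. l \<in> {i, j, k} \<and> m \<in> {i, j, k}"
  have inner: "(\<Sum>l\<in>A. \<Sum>m\<in>A. of_bool (?P i j k l m)) = (card {i, j, k})\<^sup>2"
    if "i \<in> A" "j \<in> A" "k \<in> A" for i j k
  proof -
    have *: "A \<inter> {l. l \<in> {i, j, k}} = {i, j, k}" using that by blast
    have "(\<Sum>l\<in>A. \<Sum>m\<in>A. of_bool (?P i j k l m) :: nat)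
        = (\<Sum>l\<in>A. of_bool (l \<in> {i, j, k})) * (\<Sum>m\<in>A. of_bool (m \<in> {i, j, k}))"
      by (simp only: of_bool_conj sum_product)
    then show ?thesis
      using A(1) by (simp only: sum_of_bool_eq * of_nat_id power2_eq_square)
  qed
  have d: "distinct [y, x, a, b, c]" using I(3) by auto
  have "card {g \<in> I \<rightarrow>\<^sub>E A. ?P (g a) (g b) (g c) (g x) (g y)}
      = (\<Sum>k\<in>A. \<Sum>j\<in>A. \<Sum>i\<in>A. \<Sum>l\<in>A. \<Sum>m\<in>A. of_bool (?P i j k l m)) * 7 ^ (card I - 5)"
    unfolding card_PiE_filter[OF I(1) A(1)]
    using sum_PiE_letters_5[OF I(1) A(1) I(2) d, of "\<lambda>i j k l m. of_bool (?P i j k l m)"] A(2)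
    by (simp only:)
  also have "(\<Sum>k\<in>A. \<Sum>j\<in>A. \<Sum>i\<in>A. \<Sum>l\<in>A. \<Sum>m\<in>A. of_bool (?P i j k l m))
      = (\<Sum>k\<in>A. \<Sum>j\<in>A. \<Sum>i\<in>A. (card {i, j, k})\<^sup>2)"
    by (intro sum.cong refl inner)
  also have "\<dots> = 2401"
    using sum_card_triple[OF A(1), of "\<lambda>m. m\<^sup>2"] A(2) by simp
  finally show ?thesis .
qed

section \<open>Random words and expurgation\<close>

text \<open>The random code is chosen block by block: f s is the s-th block, and f s i is the s-th
  letter of word i. A condition imposed on every block separately then cuts out a product set.\<close>

lemma card_rowwise:
  fixes m r N :: nat
  assumes A: "card A = 7" and I: "finite I" "r \<le> card I"
    and P: "card {g \<in> I \<rightarrow>\<^sub>E A. P g} = m * 7 ^ (card I - r)"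
  shows "real (card {f \<in> {..<N} \<rightarrow>\<^sub>E (I \<rightarrow>\<^sub>E A). \<forall>s<N. P (f s)})
    = real (card ({..<N} \<rightarrow>\<^sub>E (I \<rightarrow>\<^sub>E A))) * (real m / 7 ^ r) ^ N"
proof -
  have "{f \<in> {..<N} \<rightarrow>\<^sub>E (I \<rightarrow>\<^sub>E A). \<forall>s<N. P (f s)} = {..<N} \<rightarrow>\<^sub>E {g \<in> I \<rightarrow>\<^sub>E A. P g}"
    by (auto simp: PiE_iff extensional_def)
  then have "real (card {f \<in> {..<N} \<rightarrow>\<^sub>E (I \<rightarrow>\<^sub>E A). \<forall>s<N. P (f s)}) = (real m * 7 ^ (card I - r)) ^ N"
    using P by (simp add: card_PiE)
  also have "real m * 7 ^ (card I - r) = 7 ^ card I * (real m / 7 ^ r)"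
    using I(2) by (simp add: power_diff)
  finally show ?thesis using A I by (simp add: card_PiE power_mult_distrib power_divide)
qed

text \<open>Linearity of expectation, by counting the incidences of tuples and codes in two
  ways.\<close>

lemma sum_card_bad_le:
  fixes p :: real
  assumes "finite \<Omega>" "finite T"
    and "\<And>t. t \<in> T \<Longrightarrow> real (card {f \<in> \<Omega>. P t f}) \<le> p"
  shows "(\<Sum>f\<in>\<Omega>. real (card {t \<in> T. P t f})) \<le> real (card T) * p"
proof -
  have "(\<Sum>f\<in>\<Omega>. card {t \<in> T. P t f}) = (\<Sum>t\<in>T. card {f \<in> \<Omega>. P t f})"
    using assms by (intro sum_multicount_gen) auto
  then have "(\<Sum>f\<in>\<Omega>. real (card {t \<in> T. P t f})) = (\<Sum>t\<in>T. real (card {f \<in> \<Omega>. P t f}))"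
    by (simp flip: of_nat_sum)
  also have "\<dots> \<le> real (card T) * p"
    using assms(3) by (rule sum_bounded_above)
  finally show ?thesis .
qed

text \<open>Averaging yields a code f with at most K/2 bad tuples. Removing the first entry of each of
  them destroys all bad tuples and keeps half of the words.\<close>

lemma exists_separable_words:
  fixes K N :: nat
  assumes K: "5 \<le> K"
    and small: "real K ^ 3 * (13/49) ^ N + real K ^ 4 * (61/343) ^ N + real K ^ 5 * (1/7) ^ N
      \<le> real K / 2"
  obtains f S where
    "S \<subseteq> {..<K}" "K \<le> 2 * card S"
    "\<And>s i. \<lbrakk>s < N; i \<in> S\<rbrakk> \<Longrightarrow> f s i < (7::nat)"
    "\<And>a b c. \<lbrakk>a \<in> S; b \<in> S; c \<in> S; distinct [a, b, c]\<rbrakk> \<Longrightarrow> \<exists>s<N. f s a \<notin> {f s b, f s c}"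
    "\<And>a b c x. \<lbrakk>a \<in> S; b \<in> S; c \<in> S; x \<in> S; distinct [a, b, c, x]\<rbrakk>
      \<Longrightarrow> \<exists>s<N. {f s a, f s b, f s c} \<noteq> {f s x, f s b, f s c}"
    "\<And>a b c x y. \<lbrakk>a \<in> S; b \<in> S; c \<in> S; x \<in> S; y \<in> S; distinct [a, b, c, x, y]\<rbrakk>
      \<Longrightarrow> \<exists>s<N. \<not> (f s x \<in> {f s a, f s b, f s c} \<and> f s y \<in> {f s a, f s b, f s c})"
proof -
  define I where "I = {..<K}"
  define A where "A = {..<7::nat}"
  define \<Omega> where "\<Omega> = {..<N} \<rightarrow>\<^sub>E (I \<rightarrow>\<^sub>E A)"
  have I: "finite I" "card I = K" and A: "finite A" "card A = 7" by (auto simp: I_def A_def)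
  have fin\<Omega>: "finite \<Omega>" unfolding \<Omega>_def using I A by (intro finite_PiE) auto
  have "card \<Omega> > 0" unfolding \<Omega>_def using I A by (simp add: card_PiE)
  define T3 where "T3 = {(a, b, c). {a, b, c} \<subseteq> I \<and> distinct [a, b, c]}"
  define T4 where "T4 = {(a, b, c, x). {a, b, c, x} \<subseteq> I \<and> distinct [a, b, c, x]}"
  define T5 where "T5 = {(a, b, c, x, y). {a, b, c, x, y} \<subseteq> I \<and> distinct [a, b, c, x, y]}"
  define P3 where "P3 = (\<lambda>(a :: nat, b, c) f. \<forall>s<N. f s a \<in> {f s b, f s c :: nat})"
  define P4 where "P4 = (\<lambda>(a :: nat, b, c, x) f. \<forall>s<N. {f s a, f s b, f s c} = {f s x, f s b, f s c :: nat})"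
  define P5 where "P5 = (\<lambda>(a :: nat, b, c, x, y) f. \<forall>s<N. f s x \<in> {f s a, f s b, f s c :: nat}
    \<and> f s y \<in> {f s a, f s b, f s c})"
  have sub: "T3 \<subseteq> I \<times> I \<times> I" "T4 \<subseteq> I \<times> I \<times> I \<times> I" "T5 \<subseteq> I \<times> I \<times> I \<times> I \<times> I"
    by (auto simp: T3_def T4_def T5_def)
  have finT: "finite T3" "finite T4" "finite T5"
    using sub I by (auto intro: finite_subset)
  have cardT: "card T3 \<le> K ^ 3" "card T4 \<le> K ^ 4" "card T5 \<le> K ^ 5"
    using card_mono[OF _ sub(1)] card_mono[OF _ sub(2)] card_mono[OF _ sub(3)] I
    by (auto simp: card_cartesian_product eval_nat_numeral)
  let ?bad = "\<lambda>f. real (card {t \<in> T3. P3 t f}) + real (card {t \<in> T4. P4 t f})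
    + real (card {t \<in> T5. P5 t f})"
  have "\<exists>f\<in>\<Omega>. ?bad f \<le> real K / 2"
  proof (rule ccontr)
    assume "\<not> ?thesis"
    then have "\<forall>f\<in>\<Omega>. real K / 2 < ?bad f" by force
    then have "(\<Sum>f\<in>\<Omega>. real K / 2) < (\<Sum>f\<in>\<Omega>. ?bad f)"
      using fin\<Omega> \<open>card \<Omega> > 0\<close> by (intro sum_strict_mono) auto
    moreover have "(\<Sum>f\<in>\<Omega>. real (card {t \<in> T3. P3 t f})) \<le> real (card T3) * (real (card \<Omega>) * (13/49) ^ N)"
    proof (intro sum_card_bad_le fin\<Omega> finT)
      fix t assume "t \<in> T3"
      then obtain a b c where t: "t = (a, b, c)" "{a, b, c} \<subseteq> I" "distinct [a, b, c]"
        by (auto simp: T3_def)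
      show "real (card {f \<in> \<Omega>. P3 t f}) \<le> real (card \<Omega>) * (13/49) ^ N"
        using card_rowwise[OF A(2) I(1) _ card_in_pair[OF I(1) t(2,3) A], of N] K I(2)
        by (simp add: P3_def t(1) \<Omega>_def)
    qed
    moreover have "(\<Sum>f\<in>\<Omega>. real (card {t \<in> T4. P4 t f})) \<le> real (card T4) * (real (card \<Omega>) * (61/343) ^ N)"
    proof (intro sum_card_bad_le fin\<Omega> finT)
      fix t assume "t \<in> T4"
      then obtain a b c x where t: "t = (a, b, c, x)" "{a, b, c, x} \<subseteq> I" "distinct [a, b, c, x]"
        by (auto simp: T4_def)
      show "real (card {f \<in> \<Omega>. P4 t f}) \<le> real (card \<Omega>) * (61/343) ^ N"
        using card_rowwise[OF A(2) I(1) _ card_same_triple[OF I(1) t(2,3) A], of N] K I(2)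
        by (simp add: P4_def t(1) \<Omega>_def)
    qed
    moreover have "(\<Sum>f\<in>\<Omega>. real (card {t \<in> T5. P5 t f})) \<le> real (card T5) * (real (card \<Omega>) * (1/7) ^ N)"
    proof (intro sum_card_bad_le fin\<Omega> finT)
      fix t assume "t \<in> T5"
      then obtain a b c x y where t: "t = (a, b, c, x, y)" "{a, b, c, x, y} \<subseteq> I"
        "distinct [a, b, c, x, y]"
        by (auto simp: T5_def)
      show "real (card {f \<in> \<Omega>. P5 t f}) \<le> real (card \<Omega>) * (1/7) ^ N"
        using card_rowwise[OF A(2) I(1) _ card_two_in_triple[OF I(1) t(2,3) A], of N] K I(2)
        by (simp add: P5_def t(1) \<Omega>_def)
    qed
    moreover have "real (card T3) * (real (card \<Omega>) * (13/49) ^ N) \<le> real K ^ 3 * (real (card \<Omega>) * (13/49) ^ N)"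
      "real (card T4) * (real (card \<Omega>) * (61/343) ^ N) \<le> real K ^ 4 * (real (card \<Omega>) * (61/343) ^ N)"
      "real (card T5) * (real (card \<Omega>) * (1/7) ^ N) \<le> real K ^ 5 * (real (card \<Omega>) * (1/7) ^ N)"
      using cardT by (auto intro!: mult_right_mono simp flip: of_nat_power)
    ultimately have "real (card \<Omega>) * (real K / 2) < real (card \<Omega>) *
        (real K ^ 3 * (13/49) ^ N + real K ^ 4 * (61/343) ^ N + real K ^ 5 * (1/7) ^ N)"
      by (simp add: sum.distrib algebra_simps)
    then show False
      using mult_left_mono[OF small, of "real (card \<Omega>)"] by linarith
  qed
  then obtain f where f: "f \<in> \<Omega>" "?bad f \<le> real K / 2" by blast
  define D where "D = fst ` {t \<in> T3. P3 t f} \<union> fst ` {t \<in> T4. P4 t f} \<union> fst ` {t \<in> T5. P5 t f}"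
  define S where "S = I - D"
  have "card D \<le> card (fst ` {t \<in> T3. P3 t f}) + card (fst ` {t \<in> T4. P4 t f})
      + card (fst ` {t \<in> T5. P5 t f})"
    unfolding D_def by (meson add_le_mono1 card_Un_le le_trans)
  also have "\<dots> \<le> card {t \<in> T3. P3 t f} + card {t \<in> T4. P4 t f} + card {t \<in> T5. P5 t f}"
    using finT by (intro add_mono card_image_le) auto
  finally have "real (card D) \<le> real K / 2" using f(2) by linarith
  moreover have "card S \<ge> K - card D"
    unfolding S_def using I diff_card_le_card_Diff[of D I] finT by (auto simp: D_def)
  ultimately have "K \<le> 2 * card S" by linarith
  moreover have "S \<subseteq> {..<K}" by (auto simp: S_def I_def)
  moreover have "f s i < 7" if "s < N" "i \<in> S" for s i
    using f(1) that by (auto simp: \<Omega>_def S_def A_def PiE_iff)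
  moreover have "\<exists>s<N. f s a \<notin> {f s b, f s c}"
    if "a \<in> S" "b \<in> S" "c \<in> S" "distinct [a, b, c]" for a b c
  proof (rule ccontr)
    assume "\<not> ?thesis"
    then have "(a, b, c) \<in> {t \<in> T3. P3 t f}" using that by (auto simp: T3_def P3_def S_def)
    then have "a \<in> D" unfolding D_def by force
    then show False using that by (simp add: S_def)
  qed
  moreover have "\<exists>s<N. {f s a, f s b, f s c} \<noteq> {f s x, f s b, f s c}"
    if "a \<in> S" "b \<in> S" "c \<in> S" "x \<in> S" "distinct [a, b, c, x]" for a b c x
  proof (rule ccontr)
    assume "\<not> ?thesis"
    then have "(a, b, c, x) \<in> {t \<in> T4. P4 t f}" using that unfolding T4_def P4_def S_def by simp
    then have "a \<in> D" unfolding D_def by force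
    then show False using that by (simp add: S_def)
  qed
  moreover have "\<exists>s<N. \<not> (f s x \<in> {f s a, f s b, f s c} \<and> f s y \<in> {f s a, f s b, f s c})"
    if "a \<in> S" "b \<in> S" "c \<in> S" "x \<in> S" "y \<in> S" "distinct [a, b, c, x, y]" for a b c x y
  proof (rule ccontr)
    assume "\<not> ?thesis"
    then have "(a, b, c, x, y) \<in> {t \<in> T5. P5 t f}" using that unfolding T5_def P5_def S_def by simp
    then have "a \<in> D" unfolding D_def by force
    then show False using that by (simp add: S_def)
  qed
  ultimately show thesis using that by blast
qed

section \<open>The rate\<close>

lemma SSM_lower_bound:
  fixes K N :: nat
  assumes K: "5 \<le> K" "14 * N \<le> K" "1 \<le> N"
    and small: "real K ^ 3 * (13/49) ^ N + real K ^ 4 * (61/343) ^ N + real K ^ 5 * (1/7) ^ N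
      \<le> real K / 2"
  shows "K \<le> 2 * SSM 3 (7 * N)"
proof -
  obtain f S where S: "S \<subseteq> {..<K}" "K \<le> 2 * card S"
    and f: "\<And>s i. \<lbrakk>s < N; i \<in> S\<rbrakk> \<Longrightarrow> f s i < (7::nat)"
    and two: "\<And>a b c. \<lbrakk>a \<in> S; b \<in> S; c \<in> S; distinct [a, b, c]\<rbrakk> \<Longrightarrow> \<exists>s<N. f s a \<notin> {f s b, f s c}"
    and swap: "\<And>a b c x. \<lbrakk>a \<in> S; b \<in> S; c \<in> S; x \<in> S; distinct [a, b, c, x]\<rbrakk>
      \<Longrightarrow> \<exists>s<N. {f s a, f s b, f s c} \<noteq> {f s x, f s b, f s c}"
    and covered: "\<And>a b c x y. \<lbrakk>a \<in> S; b \<in> S; c \<in> S; x \<in> S; y \<in> S; distinct [a, b, c, x, y]\<rbrakk>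
      \<Longrightarrow> \<exists>s<N. \<not> (f s x \<in> {f s a, f s b, f s c} \<and> f s y \<in> {f s a, f s b, f s c})"
    by (rule exists_separable_words[OF K(1) small], rule that)
  define C where "C i = (\<lambda>s. (s, f s i)) ` {..<N}" for i
  have inC: "(s, v) \<in> C i \<longleftrightarrow> s < N \<and> v = f s i" for s v i
    by (auto simp: C_def)
  have finS: "finite S" using S(1) finite_subset by blast
  (* A repeated word would be covered by its copy together with any third word. *)
  have inj: "inj_on C S"
  proof (rule inj_onI)
    fix a b assume ab: "a \<in> S" "b \<in> S" "C a = C b"
    have eq: "f s a = f s b" if "s < N" for s
      using ab(3) inC[of s "f s a" a] inC[of s "f s a" b] that by simp
    have "card {a, b} \<le> 2" by (simp add: card_insert_if)
    then have "\<not> S \<subseteq> {a, b}" using S(2) K(1) card_mono[of "{a, b}" S] by auto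
    then obtain c where "c \<in> S" "c \<noteq> a" "c \<noteq> b" by blast
    then show "a = b" using two[of a b c] ab eq by auto
  qed
  have "separable_system 3 (C ` S)"
  proof (rule separable_system_3_image)
    fix a b c assume abc: "a \<in> S" "b \<in> S" "c \<in> S" "distinct [a, b, c]"
    obtain s where "s < N" "f s a \<notin> {f s b, f s c}" using two[OF abc] by blast
    then have "(s, f s a) \<in> C a" "(s, f s a) \<notin> C b \<union> C c" by (auto simp: inC)
    then show "\<not> C a \<subseteq> C b \<union> C c" by blast
  next
    fix a b c x assume abcx: "a \<in> S" "b \<in> S" "c \<in> S" "x \<in> S" "distinct [a, b, c, x]"
    obtain s where s: "s < N" "{f s a, f s b, f s c} \<noteq> {f s x, f s b, f s c}"
      using swap[OF abcx] by blast
    have "{v. (s, v) \<in> C a \<union> C b \<union> C c} = {f s a, f s b, f s c}"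
      "{v. (s, v) \<in> C x \<union> C b \<union> C c} = {f s x, f s b, f s c}"
      using s(1) by (auto simp: inC)
    then show "C a \<union> C b \<union> C c \<noteq> C x \<union> C b \<union> C c" using s(2) by metis
  next
    fix a b c x y assume abcxy: "a \<in> S" "b \<in> S" "c \<in> S" "x \<in> S" "y \<in> S" "distinct [a, b, c, x, y]"
    obtain s where s: "s < N" "\<not> (f s x \<in> {f s a, f s b, f s c} \<and> f s y \<in> {f s a, f s b, f s c})"
      using covered[OF abcxy] by blast
    have "(s, f s z) \<in> C z" "(s, f s z) \<in> C a \<union> C b \<union> C c \<longleftrightarrow> f s z \<in> {f s a, f s b, f s c}" for z
      using s(1) by (auto simp: inC)
    then show "\<not> (C x \<subseteq> C a \<union> C b \<union> C c \<and> C y \<subseteq> C a \<union> C b \<union> C c)" using s(2) by blast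
  qed
  moreover have "C ` S \<subseteq> Pow ({..<N} \<times> {..<7})"
    using f by (auto simp: C_def)
  moreover have "card (C ` S) = card S" using inj by (rule card_image)
  ultimately have "card S \<le> SSM 3 (7 * N)"
    using card_le_SSM[of "{..<N} \<times> {..<7::nat}" "7 * N" "C ` S" 3] S(2) K by simp
  then show ?thesis using S(2) by linarith
qed

text \<open>The three terms of the expurgation bound, divided by K, are at most the N-th powers of
  (13/8)^2 * 13/49 = 2197/3136, (13/8)^3 * 61/343 = 134017/175616 and
  (13/8)^4 / 7 = 28561/28672. All three bases are below 1, so each term eventually drops below
  K/6. The factor 4 absorbs both the rounding of (13/8)^N to K and the
  expurgated half.\<close>

lemma eventually_SSM_ge:
  "\<forall>\<^sub>F N in sequentially. (13/8) ^ N \<le> 4 * real (SSM 3 (7 * N))"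
proof -
  have lim: "(\<lambda>N. r ^ N) \<longlonglongrightarrow> 0" if "0 \<le> r" "r < 1" for r :: real
    using that by (intro LIMSEQ_power_zero) auto
  have "\<forall>\<^sub>F N in sequentially. (2197/3136 :: real) ^ N < 1/6"
    "\<forall>\<^sub>F N in sequentially. (134017/175616 :: real) ^ N < 1/6"
    "\<forall>\<^sub>F N in sequentially. (28561/28672 :: real) ^ N < 1/6"
    by (rule order_tendstoD(2)[OF lim]; simp)+
  moreover have "\<forall>\<^sub>F N in sequentially. 14 * real N + 6 \<le> (13/8) ^ N"
    by real_asymp
  ultimately show ?thesis
    using eventually_ge_at_top[of "1::nat"]
  proof eventually_elim
    case (elim N)
    define \<beta> :: real where "\<beta> = (13/8) ^ N"
    define K where "K = nat \<lfloor>\<beta>\<rfloor>"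
    have K: "real K \<le> \<beta>" "\<beta> < real K + 1"
      using elim(4) by (auto simp: K_def \<beta>_def)
    have K5: "5 \<le> K" "14 * N \<le> K"
      using K elim(4) unfolding \<beta>_def[symmetric] by linarith+
    have bound: "real K ^ Suc m * q ^ N \<le> real K * ((13/8) ^ m * q) ^ N" if "0 \<le> q" for m q
    proof -
      have "real K ^ m \<le> \<beta> ^ m" using K by (intro power_mono) auto
      then have "real K * (real K ^ m * q ^ N) \<le> real K * (\<beta> ^ m * q ^ N)"
        using that by (intro mult_left_mono mult_right_mono) auto
      also have "\<beta> ^ m * q ^ N = ((13/8) ^ m * q) ^ N"
        by (simp add: \<beta>_def power_mult_distrib mult.commute flip: power_mult)
      finally show ?thesis by (simp add: mult.assoc)
    qed
    have le: "real K * t \<le> real K * (1/6)" if "t < 1/6" for t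
      using that by (intro mult_left_mono) auto
    have "real K ^ 3 * (13/49) ^ N \<le> real K * (1/6)"
      using bound[of "13/49" 2] le[OF elim(1)] by (simp add: eval_nat_numeral)
    moreover have "real K ^ 4 * (61/343) ^ N \<le> real K * (1/6)"
      using bound[of "61/343" 3] le[OF elim(2)] by (simp add: eval_nat_numeral)
    moreover have "real K ^ 5 * (1/7) ^ N \<le> real K * (1/6)"
      using bound[of "1/7" 4] le[OF elim(3)] by (simp add: eval_nat_numeral)
    ultimately have "K \<le> 2 * SSM 3 (7 * N)"
      using K5 elim(5) by (intro SSM_lower_bound) auto
    then show ?case using K K5 unfolding \<beta>_def[symmetric] by linarith
  qed
qed

theorem mainTheorem3: "SSM_rate 3 \<ge> ereal 0.0974"
proof -
  have log: "7/10 \<le> log 2 (13/8)"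
  proof -
    have "(2::real) ^ 7 \<le> (13/8) ^ 10" by (simp add: power_divide)
    then have "log 2 (2 ^ 7) \<le> log 2 ((13/8) ^ 10 :: real)" by (subst log_le_cancel_iff) auto
    moreover have "log 2 (2 ^ 7) = (7 :: real)" by (subst log_pow_cancel) auto
    moreover have "log 2 ((13/8) ^ 10 :: real) = 10 * log 2 (13/8)"
      by (subst log_nat_power) auto
    ultimately show ?thesis by linarith
  qed
  (* The factor 4 costs 2 in the logarithm, and 0.7 N - 2 \<ge> 0.0974 * 7 N from N = 110 on. *)
  have "\<forall>\<^sub>F N in sequentially. 0.0974 \<le> log 2 (real (SSM 3 (7 * N))) / real (7 * N)"
    using eventually_SSM_ge eventually_ge_at_top[of 110]
  proof eventually_elim
    case (elim N)
    have "0 < (13/8 :: real) ^ N" by simp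
    then have pos: "0 < real (SSM 3 (7 * N))" using elim(1) by linarith
    have "real N * (7/10) \<le> real N * log 2 (13/8)" using log by (intro mult_left_mono) auto
    also have "\<dots> = log 2 ((13/8) ^ N)" by (simp add: log_nat_power)
    also have "\<dots> \<le> log 2 (4 * real (SSM 3 (7 * N)))"
      using elim(1) pos by (subst log_le_cancel_iff) auto
    also have "\<dots> = 2 + log 2 (real (SSM 3 (7 * N)))"
      using pos log_nat_power[of 2 2 2] by (simp add: log_mult)
    finally show ?case using elim(2) by (simp add: field_simps)
  qed
  then have ev: "\<forall>\<^sub>F N in sequentially. ereal 0.0974 \<le> ereal (log 2 (real (SSM 3 (7 * N))) / real (7 * N))"
    by simp
  have "ereal 0.0974 \<le> limsup (\<lambda>N. ereal (log 2 (real (SSM 3 (7 * N))) / real (7 * N)))"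
    by (rule le_Limsup[OF _ ev]) simp
  also have "\<dots> \<le> SSM_rate 3"
    unfolding SSM_rate_def
    using limsup_subseq_mono[of "(*) 7" "\<lambda>n. ereal (log 2 (real (SSM 3 n)) / real n)"]
    by (simp add: o_def strict_mono_def)
  finally show ?thesis .
qed

end
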